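(* Let $H$ be a (not necessarily semibounded) self-adjoint operator with bounded inverse in a Hilbert space $\mathcal{H}$, let $\mathcal{U}$ be a (not necessarily finite dimensional) closed subspace of $\mathcal{H}$ such that $\operatorname{Dom}(H)$ is invariant for the orthogonal projection $P_{\mathcal{U}}$ onto $\mathcal{U}$, let $\mathcal{V} = \operatorname{Ran} H|_{\mathcal{U}}$ and $\mathcal{W} = \overline{\operatorname{Ran} H^{-1}|_{\mathcal{U}}}$, and let $P = H P_{\mathcal{U}} H^{-1}$. Then $$\lVert P_{\mathcal{U}} - P \rVert \leq \min\bigl\{ \sin\theta(\mathcal{U},\mathcal{V}), \sin\theta(\mathcal{U},\mathcal{W}) \bigr\} + \tan\theta(\mathcal{V},\mathcal{W}).$$
   Context: Invariance of $\operatorname{Dom}(H)$ for $P_{\mathcal{U}}$ means $P_{\mathcal{U}} \operatorname{Dom}(H) \subset \operatorname{Dom}(H)$. $\operatorname{Ran} H|_{\mathcal{U}} = \{Hu : u \in \operatorname{Dom}(H) \cap \mathcal{U}\}$, which is a closed subspace, and $\operatorname{Ran} H^{-1}|_{\mathcal{U}} = \{H^{-1}u : u \in \mathcal{U}\}$. The operator $P = H P_{\mathcal{U}} H^{-1}$ is everywhere defined and bounded, and is the (in general non-orthogonal) projection onto $\mathcal{V}$ along $\mathcal{W}^\perp$. For a closed subspace $\mathcal{M}$ of $\mathcal{H}$, $P_{\mathcal{M}}$ denotes the orthogonal projection onto $\mathcal{M}$. The maximal angle between two closed subspaces $\mathcal{M}$ and $\mathcal{N}$ of $\mathcal{H}$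 is $\theta(\mathcal{M},\mathcal{N}) = \arcsin(\lVert P_{\mathcal{M}} - P_{\mathcal{N}} \rVert)$. In this setting $\lVert P_{\mathcal{V}} - P_{\mathcal{W}} \rVert < 1$, so $\tan\theta(\mathcal{V},\mathcal{W})$ is finite. *)

theory Defs
  imports "HOL-Analysis.Analysis"
begin

text \<open>
  Complex Hilbert spaces, built on top of the underlying real inner product space so that norm,
  topology and completeness are those of the library. The sesquilinear form is conjugate-linear in
  its first argument; its positive definiteness follows from \<open>inner_eq_Re_cinner\<close>.
\<close>

class complex_hilbert = real_inner + complete_space +
  fixes scaleC :: "complex \<Rightarrow> 'a \<Rightarrow> 'a"  (infixr \<open>*\<^sub>C\<close> 75)
    and cinner :: "'a \<Rightarrow> 'a \<Rightarrow> complex"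
  assumes scaleC_add_right: "scaleC a (x + y) = scaleC a x + scaleC a y"
    and scaleC_add_left: "scaleC (a + b) x = scaleC a x + scaleC b x"
    and scaleC_scaleC: "scaleC a (scaleC b x) = scaleC (a * b) x"
    and scaleR_scaleC: "scaleR r x = scaleC (complex_of_real r) x"
    and cinner_commute: "cinner x y = cnj (cinner y x)"
    and cinner_add_left: "cinner (x + y) z = cinner x z + cinner y z"
    and cinner_scaleC_left: "cinner (scaleC a x) y = cnj a * cinner x y"
    and inner_eq_Re_cinner: "inner x y = Re (cinner x y)"

global_interpretation complex_vector:
  vector_space "scaleC :: complex \<Rightarrow> 'a \<Rightarrow> 'a::complex_hilbert"
proof
  show "scaleC 1 x = x" for x :: 'a
    using scaleR_scaleC[of 1 x] by simp
qed (simp_all add: scaleC_add_right scaleC_add_left scaleC_scaleC)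

instantiation complex :: complex_hilbert
begin

definition scaleC_complex :: "complex \<Rightarrow> complex \<Rightarrow> complex"
  where "scaleC_complex a x = a * x"

definition cinner_complex :: "complex \<Rightarrow> complex \<Rightarrow> complex"
  where "cinner_complex x y = cnj x * y"

instance
  by standard
    (auto simp: scaleC_complex_def cinner_complex_def inner_complex_def scaleR_conv_of_real
      algebra_simps)

end

definition orth_proj :: "'a::complex_hilbert set \<Rightarrow> 'a \<Rightarrow> 'a"
  where "orth_proj M x = (THE y. y \<in> M \<and> (\<forall>z\<in>M. cinner z (x - y) = 0))"

definition max_angle :: "'a::complex_hilbert set \<Rightarrow> 'a set \<Rightarrow> real"
  where "max_angle M N = arcsin (onorm (\<lambda>x. orth_proj M x - orth_proj N x))"

text \<open>
  An unbounded operator is given by its domain \<open>D\<close> together with a total function \<open>H\<close>, whose values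
  outside \<open>D\<close> are irrelevant.
\<close>

definition linear_operator :: "'a::complex_hilbert set \<Rightarrow> ('a \<Rightarrow> 'a) \<Rightarrow> bool"
  where "linear_operator D H \<longleftrightarrow>
    complex_vector.subspace D \<and>
    (\<forall>x\<in>D. \<forall>y\<in>D. H (x + y) = H x + H y) \<and>
    (\<forall>a. \<forall>x\<in>D. H (a *\<^sub>C x) = a *\<^sub>C H x)"

definition adjoint_domain :: "'a::complex_hilbert set \<Rightarrow> ('a \<Rightarrow> 'a) \<Rightarrow> 'a set"
  where "adjoint_domain D H = {y. \<exists>z. \<forall>x\<in>D. cinner (H x) y = cinner x z}"

definition adjoint_operator :: "'a::complex_hilbert set \<Rightarrow> ('a \<Rightarrow> 'a) \<Rightarrow> 'a \<Rightarrow> 'a"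
  where "adjoint_operator D H y = (THE z. \<forall>x\<in>D. cinner (H x) y = cinner x z)"

definition self_adjoint :: "'a::complex_hilbert set \<Rightarrow> ('a \<Rightarrow> 'a) \<Rightarrow> bool"
  where "self_adjoint D H \<longleftrightarrow>
    linear_operator D H \<and> closure D = UNIV \<and>
    adjoint_domain D H = D \<and> (\<forall>y\<in>D. adjoint_operator D H y = H y)"

text \<open>The inverse of \<open>H\<close>, defined on the range of \<open>H\<close>, is \<open>inv_into D H\<close>.\<close>

definition has_bounded_inverse :: "'a::complex_hilbert set \<Rightarrow> ('a \<Rightarrow> 'a) \<Rightarrow> bool"
  where "has_bounded_inverse D H \<longleftrightarrow> bij_betw H D UNIV \<and> bounded_linear (inv_into D H)"

end

theory Submission
  imports Defs
begin

text \<open>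
  The operator \<open>P\<close> is idempotent because \<open>H\<close> and its inverse \<open>T\<close> cancel and \<open>orth_proj U\<close> is
  idempotent; its range is \<open>V\<close>, and since \<open>T\<close> is symmetric, its kernel is the orthogonal complement
  of \<open>T ` U\<close>, hence of \<open>W\<close> (\<open>oblique_projection_conjugate\<close>). It is bounded by an argument of
  Hellinger-Toeplitz type: \<open>P x \<bullet> y\<close> is continuous in \<open>x\<close> whenever \<open>y\<close> lies in the dense domain of
  \<open>H\<close>, and on a complete space this forces continuity in norm, by the Baire category theorem
  (\<open>bounded_linear_if_weakly_continuous\<close>).

  What remains is the geometry of a bounded projection \<open>P\<close> onto \<open>V\<close> along the complement of \<open>W\<close>.
  Write \<open>p\<close>, \<open>q\<close> for the orthogonal projections onto \<open>V\<close>, \<open>W\<close> and \<open>s\<close> for the norm of \<open>p - q\<close>.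
  Boundedness of \<open>P\<close> keeps \<open>V\<close> and \<open>W\<close> at a positive angle from each other's complements, which
  gives \<open>s < 1\<close> (\<open>onorm_diff_less_1\<close>). The vector \<open>P x\<close> decomposes orthogonally as \<open>q x\<close> plus
  \<open>P x - q x = (p - q) (P x)\<close>, so the second part is at most \<open>s\<close> times the hypotenuse, hence at most
  \<open>s / sqrt (1 - s\<^sup>2)\<close>, the tangent of the angle, times the first part. Thus \<open>P\<close> is within
  the tangent of \<open>q\<close>, and the same right triangle drawn for \<open>x - P x\<close> shows that it is within the
  tangent of \<open>p\<close> (\<open>norm_diff_onto_complement_le\<close>, \<open>norm_diff_onto_range_le\<close>). Comparing
  \<open>orth_proj U\<close> with \<open>P\<close> through \<open>p\<close> or through \<open>q\<close>, whichever is nearer, gives the theorem.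

  All of the geometry involves only the real inner product. The complex structure enters when
  \<open>orth_proj\<close> is identified: on a complex subspace, orthogonality for the sesquilinear form and for
  its real part agree.
\<close>

section \<open>The projection theorem\<close>

text \<open>
  By the parallelogram law, two nearly closest points of \<open>M\<close> are near each other, because their
  midpoint also lies in \<open>M\<close> and so cannot be much closer to \<open>x\<close> than they are.
\<close>

lemma minimizing_sequence_Cauchy:
  fixes X :: "nat \<Rightarrow> 'a::real_inner"
  assumes M: "subspace M" and X: "\<And>n. X n \<in> M"
    and low: "\<And>m. m \<in> M \<Longrightarrow> d \<le> (norm (x - m))\<^sup>2"
    and up: "\<And>n. (norm (x - X n))\<^sup>2 < d + \<delta> n" and \<delta>: "\<delta> \<longlonglongrightarrow> 0"
  shows "Cauchy X"
proof (rule metric_CauchyI)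
  fix e :: real
  assume e: "0 < e"
  then obtain N where N: "\<And>n. N \<le> n \<Longrightarrow> \<delta> n < e\<^sup>2 / 4"
    using order_tendstoD(2)[OF \<delta>, of "e\<^sup>2 / 4"] by (auto simp: eventually_sequentially)
  have "dist (X m) (X n) < e" if "N \<le> m" "N \<le> n" for m n
  proof -
    have mid: "(1/2) *\<^sub>R (X m + X n) \<in> M"
      using M X by (simp add: subspace_add subspace_scale)
    have "(norm (X m - X n))\<^sup>2 = 2 * (norm (x - X m))\<^sup>2 + 2 * (norm (x - X n))\<^sup>2
        - 4 * (norm (x - (1/2) *\<^sub>R (X m + X n)))\<^sup>2"
      by (simp add: power2_norm_eq_inner inner_simps inner_commute algebra_simps)
    also have "\<dots> < e\<^sup>2"
      using up[of m] up[of n] low[OF mid] N[OF that(1)] N[OF that(2)] by linarith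
    finally show ?thesis
      using e by (simp add: dist_norm power_less_imp_less_base)
  qed
  then show "\<exists>N. \<forall>m\<ge>N. \<forall>n\<ge>N. dist (X m) (X n) < e"
    by blast
qed

text \<open>
  The closest point of \<open>M\<close> works: moving away from it in the directions \<open>z\<close> and \<open>- z\<close> does not
  decrease the distance to \<open>x\<close>.
\<close>

lemma exists_orthogonal_projection:
  fixes M :: "'a::{real_inner, complete_space} set"
  assumes M: "subspace M" and cl: "closed M"
  shows "\<exists>y\<in>M. \<forall>z\<in>M. z \<bullet> (x - y) = 0"
proof -
  define d where "d = (INF m\<in>M. (norm (x - m))\<^sup>2)"
  have ne: "M \<noteq> {}"
    using subspace_0[OF M] by blast
  have bdd: "bdd_below ((\<lambda>m. (norm (x - m))\<^sup>2) ` M)"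
    by (rule bdd_belowI[of _ 0]) auto
  have low: "d \<le> (norm (x - m))\<^sup>2" if "m \<in> M" for m
    unfolding d_def using bdd that by (rule cINF_lower)
  have "\<exists>m\<in>M. (norm (x - m))\<^sup>2 < d + inverse (real (Suc n))" for n
    using cInf_lessD[of "(\<lambda>m. (norm (x - m))\<^sup>2) ` M" "d + inverse (real (Suc n))"] ne
    unfolding d_def[symmetric] by (auto simp: d_def)
  then obtain X where X: "\<And>n. X n \<in> M"
    and up: "\<And>n. (norm (x - X n))\<^sup>2 < d + inverse (real (Suc n))"
    by metis
  have "Cauchy X"
    using M X low up LIMSEQ_inverse_real_of_nat by (rule minimizing_sequence_Cauchy)
  then obtain y where y: "X \<longlonglongrightarrow> y"
    using Cauchy_convergent convergent_def by blast
  have yM: "y \<in> M"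
    using cl X y by (metis closed_sequentially)
  have "(\<lambda>n. (norm (x - X n))\<^sup>2) \<longlonglongrightarrow> (norm (x - y))\<^sup>2"
    by (intro tendsto_intros y)
  moreover have "(\<lambda>n. d + inverse (real (Suc n))) \<longlonglongrightarrow> d + 0"
    by (intro tendsto_intros LIMSEQ_inverse_real_of_nat)
  ultimately have "(norm (x - y))\<^sup>2 \<le> d + 0"
    using up by (meson LIMSEQ_le less_imp_le)
  then have "(norm (x - y))\<^sup>2 \<le> (norm (x - m))\<^sup>2" if "m \<in> M" for m
    using low[OF that] by linarith
  then have closest: "\<forall>m\<in>M. dist x y \<le> dist x m"
    by (auto simp: dist_norm intro: power2_le_imp_le)
  have "z \<bullet> (x - y) = 0" if z: "z \<in> M" for z
  proof -
    have "(x - y) \<bullet> ((y + z) - y) \<le> 0" "(x - y) \<bullet> ((y - z) - y) \<le> 0"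
      using any_closest_point_dot[OF subspace_imp_convex[OF M] cl yM _ closest]
        subspace_add[OF M yM z] subspace_diff[OF M yM z] by blast+
    then show ?thesis
      by (simp add: inner_commute)
  qed
  with yM show ?thesis by blast
qed

section \<open>Orthogonal and oblique projections\<close>

locale orthogonal_projection =
  fixes M :: "'a::real_inner set" and p :: "'a \<Rightarrow> 'a"
  assumes subspace: "subspace M"
    and mem: "p x \<in> M"
    and residual: "z \<in> M \<Longrightarrow> z \<bullet> (x - p x) = 0"
begin

lemma unique: "y = p x" if "y \<in> M" "\<And>z. z \<in> M \<Longrightarrow> z \<bullet> (x - y) = 0"
proof -
  have "y - p x \<in> M"
    using that mem subspace by (simp add: subspace_diff)
  then have "(y - p x) \<bullet> (x - p x) = 0" "(y - p x) \<bullet> (x - y) = 0"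
    using that residual by blast+
  then have "(y - p x) \<bullet> (y - p x) = 0"
    by (simp add: inner_simps)
  then show ?thesis by simp
qed

lemma fixes_mem: "x \<in> M \<Longrightarrow> p x = x"
  using unique[of x x] by simp

lemma vanishes: "(\<And>z. z \<in> M \<Longrightarrow> z \<bullet> x = 0) \<Longrightarrow> p x = 0"
  using unique[of 0 x] subspace_0[OF subspace] by simp

lemma inner_right: "z \<in> M \<Longrightarrow> z \<bullet> p x = z \<bullet> x"
  using residual[of z x] by (simp add: inner_simps)

lemma symmetric: "p x \<bullet> y = x \<bullet> p y"
  using inner_right[of "p x" y] inner_right[of "p y" x] mem by (simp add: inner_commute)

lemma pythagoras: "(norm x)\<^sup>2 = (norm (p x))\<^sup>2 + (norm (x - p x))\<^sup>2"
  using residual[of "p x" x] mem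
  by (simp add: power2_norm_eq_inner inner_simps inner_commute)

lemma contraction: "norm (p x) \<le> norm x"
  by (rule power2_le_imp_le) (simp_all add: pythagoras[of x])

lemma residual_contraction: "norm (x - p x) \<le> norm x"
  by (rule power2_le_imp_le) (simp_all add: pythagoras[of x])

lemma add: "p (x + y) = p x + p y"
proof (rule unique[symmetric])
  show "p x + p y \<in> M" by (simp add: subspace subspace_add mem)
  show "z \<bullet> (x + y - (p x + p y)) = 0" if "z \<in> M" for z
    using residual[OF that, of x] residual[OF that, of y] by (simp add: inner_simps)
qed

lemma scale: "p (r *\<^sub>R x) = r *\<^sub>R p x"
proof (rule unique[symmetric])
  show "r *\<^sub>R p x \<in> M" by (simp add: subspace subspace_scale mem)
  show "z \<bullet> (r *\<^sub>R x - r *\<^sub>R p x) = 0" if "z \<in> M" for z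
    using residual[OF that, of x] by (simp add: inner_simps)
qed

lemma bounded_linear: "bounded_linear p"
  by (rule bounded_linear_intro[where K = 1]) (simp_all add: add scale contraction)

lemma diff: "p (x - y) = p x - p y"
  by (rule linear_diff[OF bounded_linear.linear[OF bounded_linear]])

end

text \<open>
  This is how the norm of a difference of orthogonal projections is controlled by the two one-sided
  gaps between the subspaces. The difference splits as \<open>p x - q x = p (x - q x) - (q x - p (q x))\<close>
  into two orthogonal vectors, and \<open>x\<close> splits into the orthogonal vectors \<open>x - q x\<close> and \<open>q x\<close>. The
  gap of \<open>N\<close> bounds the second part directly; that of \<open>M\<close> bounds the first by duality.
\<close>

lemma norm_diff_orthogonal_projection_le:
  fixes p q :: "'a::real_inner \<Rightarrow> 'a"
  assumes "orthogonal_projection M p" and "orthogonal_projection N q" and c: "0 \<le> c"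
    and MN: "\<And>v. v \<in> M \<Longrightarrow> norm (v - q v) \<le> c * norm v"
    and NM: "\<And>w. w \<in> N \<Longrightarrow> norm (w - p w) \<le> c * norm w"
  shows "norm (p x - q x) \<le> c * norm x"
proof -
  interpret p: orthogonal_projection M p by fact
  interpret q: orthogonal_projection N q by fact
  define y where "y = x - q x"
  \<comment> \<open>Duality: \<open>p y\<close> may be replaced by \<open>p y - q (p y)\<close>, as \<open>y\<close> is orthogonal to \<open>N\<close>.\<close>
  have "(norm (p y))\<^sup>2 = (p y - q (p y)) \<bullet> y"
  proof -
    have "q (p y) \<bullet> y = 0"
      unfolding y_def using q.residual q.mem by blast
    moreover have "p y \<bullet> p y = p y \<bullet> y"
      using p.inner_right p.mem by blast
    ultimately show ?thesis by (simp add: power2_norm_eq_inner inner_simps)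
  qed
  also have "\<dots> \<le> norm (p y - q (p y)) * norm y"
    by (rule norm_cauchy_schwarz)
  also have "\<dots> \<le> c * norm (p y) * norm y"
    using MN[OF p.mem] by (simp add: mult_right_mono)
  finally have "norm (p y) * norm (p y) \<le> (c * norm y) * norm (p y)"
    by (simp add: power2_eq_square mult_ac)
  then have py: "norm (p y) \<le> c * norm y"
    using c by (cases "p y = 0") (auto simp: mult_le_cancel_right)
  have qx: "norm (q x - p (q x)) \<le> c * norm (q x)"
    using NM q.mem by blast
  have "p x - q x = p y - (q x - p (q x))"
    by (simp add: y_def p.diff)
  moreover have "p y \<bullet> (q x - p (q x)) = 0"
    using p.residual p.mem by blast
  ultimately have "(norm (p x - q x))\<^sup>2 = (norm (p y))\<^sup>2 + (norm (q x - p (q x)))\<^sup>2"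
    by (simp add: power2_norm_eq_inner inner_simps inner_commute)
  also have "\<dots> \<le> (c * norm y)\<^sup>2 + (c * norm (q x))\<^sup>2"
    using py qx by (intro add_mono power_mono) auto
  also have "\<dots> = (c * norm x)\<^sup>2"
    using q.pythagoras[of x] by (simp add: y_def power_mult_distrib distrib_left[symmetric])
  finally show ?thesis
    by (rule power2_le_imp_le) (simp add: c)
qed

lemma onorm_diff_orthogonal_projection_le_1:
  assumes "orthogonal_projection M p" and "orthogonal_projection N q"
  shows "onorm (\<lambda>x. p x - q x) \<le> 1"
proof (rule onorm_bound)
  show "norm (p x - q x) \<le> 1 * norm x" for x
    using orthogonal_projection.residual_contraction[OF assms(1)]
      orthogonal_projection.residual_contraction[OF assms(2)]
    by (intro norm_diff_orthogonal_projection_le[OF assms]) simp_all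
qed simp

text \<open>
  In a right triangle with legs \<open>a\<close> and \<open>b\<close> whose leg \<open>a\<close> is at most \<open>s\<close> times the hypotenuse, the
  angle opposite to \<open>a\<close> is at most \<open>arcsin s\<close>.
\<close>

lemma tan_arcsin_le:
  fixes a b s :: real
  assumes s: "0 \<le> s" "s < 1" and "0 \<le> b" and le: "a\<^sup>2 \<le> s\<^sup>2 * (a\<^sup>2 + b\<^sup>2)"
  shows "a \<le> tan (arcsin s) * b"
proof -
  have pos: "0 < 1 - s\<^sup>2"
    using s by (simp add: abs_square_less_1)
  have t: "tan (arcsin s) = s / sqrt (1 - s\<^sup>2)"
    using s by (simp add: tan_def cos_arcsin)
  have "a\<^sup>2 * (1 - s\<^sup>2) \<le> s\<^sup>2 * b\<^sup>2"
    using le by (simp add: algebra_simps)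
  then have "a\<^sup>2 \<le> (s / sqrt (1 - s\<^sup>2) * b)\<^sup>2"
    using pos by (simp add: power_divide power_mult_distrib pos_le_divide_eq)
  moreover have "0 \<le> s / sqrt (1 - s\<^sup>2) * b"
    using assms pos by simp
  ultimately show ?thesis
    unfolding t by (rule power2_le_imp_le)
qed

text \<open>
  Here \<open>P\<close> is the bounded, generally non-orthogonal projection onto \<open>V\<close> along the orthogonal
  complement of \<open>W\<close>.
\<close>

locale oblique_projection =
  p: orthogonal_projection V p + q: orthogonal_projection W q
  for V W :: "'a::real_inner set" and p q :: "'a \<Rightarrow> 'a" +
  fixes P :: "'a \<Rightarrow> 'a"
  assumes bounded_linear: "bounded_linear P"
    and range: "P x \<in> V"
    and fixes_mem: "v \<in> V \<Longrightarrow> P v = v"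
    and kernel: "P x = 0 \<longleftrightarrow> (\<forall>w\<in>W. w \<bullet> x = 0)"
begin

lemma diff: "P (x - y) = P x - P y"
  by (rule linear_diff[OF bounded_linear.linear[OF bounded_linear]])

lemma inner_right: "w \<in> W \<Longrightarrow> w \<bullet> P x = w \<bullet> x"
  using kernel[of "x - P x"] fixes_mem[OF range, of x] by (simp add: diff inner_simps)

lemma q_P: "q (P x) = q x"
  by (rule q.unique[symmetric]) (use q.mem q.inner_right inner_right in \<open>auto simp: inner_simps\<close>)

lemma P_q: "P (q x) = P x"
  using kernel[of "x - q x"] q.residual[of _ x] by (simp add: diff)

text \<open>
  With \<open>K\<close> a bound for \<open>P\<close>, every \<open>v\<close> in \<open>V\<close> satisfies \<open>v = P (q v)\<close>, so \<open>norm v \<le> K * norm (q v)\<close>: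
  orthogonal projection to \<open>W\<close> shrinks \<open>V\<close> at most by the factor \<open>K\<close>. The adjoint of \<open>P\<close> projects
  onto \<open>W\<close> along the complement of \<open>V\<close> and has the same norm, which is why the estimate also holds
  with \<open>V\<close> and \<open>W\<close> exchanged. By Pythagoras both gaps are then at most \<open>sqrt (1 - 1 / K\<^sup>2)\<close>.
\<close>

lemma onorm_diff_less_1: "onorm (\<lambda>x. p x - q x) < 1"
proof -
  obtain C where C: "C > 0" "\<And>x. norm (P x) \<le> norm x * C"
    using bounded_linear.pos_bounded[OF bounded_linear] by blast
  \<comment> \<open>Taking the bound to be at least 1 makes the radicand nonnegative even if \<open>P\<close> is zero.\<close>
  define c where "c = sqrt (1 - 1 / (max C 1)\<^sup>2)"
  have K: "1 \<le> max C 1" "0 \<le> 1 - 1 / (max C 1)\<^sup>2"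
    by (auto simp: divide_le_eq_1)
  have bound: "norm (P x) \<le> max C 1 * norm x" for x
    using C(2)[of x] mult_right_mono[of C "max C 1" "norm x"] by (simp add: mult.commute)
  have gap: "norm r \<le> c * norm z"
    if "(norm z)\<^sup>2 = (norm y)\<^sup>2 + (norm r)\<^sup>2" "norm z \<le> max C 1 * norm y" for y z r :: 'a
  proof (rule power2_le_imp_le)
    have "(norm z)\<^sup>2 \<le> (max C 1)\<^sup>2 * (norm y)\<^sup>2"
      using that(2) by (metis norm_ge_zero power_mono power_mult_distrib)
    then have "(norm z)\<^sup>2 / (max C 1)\<^sup>2 \<le> (norm y)\<^sup>2"
      using K(1) by (simp add: divide_le_eq mult.commute)
    moreover have "(c * norm z)\<^sup>2 = (norm z)\<^sup>2 - (norm z)\<^sup>2 / (max C 1)\<^sup>2"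
      using K(2) by (simp add: c_def power_mult_distrib left_diff_distrib)
    ultimately show "(norm r)\<^sup>2 \<le> (c * norm z)\<^sup>2"
      using that(1) by linarith
    show "0 \<le> c * norm z"
      using K(2) by (simp add: c_def)
  qed
  have V: "norm (v - q v) \<le> c * norm v" if "v \<in> V" for v
  proof (rule gap[OF q.pythagoras])
    show "norm v \<le> max C 1 * norm (q v)"
      using bound[of "q v"] by (simp add: P_q fixes_mem that)
  qed
  have W: "norm (w - p w) \<le> c * norm w" if "w \<in> W" for w
  proof (rule gap[OF p.pythagoras])
    have "(norm w)\<^sup>2 = p w \<bullet> P w"
      using inner_right[OF that, of w] p.symmetric[of w "P w"] p.fixes_mem[OF range, of w]
      by (simp add: power2_norm_eq_inner)
    also have "\<dots> \<le> norm (p w) * norm (P w)"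
      by (rule norm_cauchy_schwarz)
    also have "\<dots> \<le> norm (p w) * (max C 1 * norm w)"
      by (rule mult_left_mono[OF bound]) simp
    finally have "norm w * norm w \<le> (max C 1 * norm (p w)) * norm w"
      by (simp add: power2_eq_square mult_ac)
    then show "norm w \<le> max C 1 * norm (p w)"
      by (cases "w = 0") (auto simp: mult_le_cancel_right)
  qed
  have "norm (p x - q x) \<le> c * norm x" for x
    using norm_diff_orthogonal_projection_le[OF p.orthogonal_projection_axioms
        q.orthogonal_projection_axioms _ V W] K(2) by (simp add: c_def)
  then have "onorm (\<lambda>x. p x - q x) \<le> c"
    using K(2) by (intro onorm_bound) (simp_all add: c_def)
  also have "c < 1"
    using K(1) by (simp add: c_def)
  finally show ?thesis .
qed

lemma bounded_linear_diff: "bounded_linear (\<lambda>x. p x - q x)"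
  by (rule bounded_linear_sub[OF p.bounded_linear q.bounded_linear])

lemma tan_arcsin_onorm_diff_nonneg: "0 \<le> tan (arcsin (onorm (\<lambda>x. p x - q x)))"
proof -
  have "0 \<le> s \<Longrightarrow> s < 1 \<Longrightarrow> 0 \<le> tan (arcsin s)" for s :: real
    by (simp add: tan_def cos_arcsin power_le_one)
  then show ?thesis
    using onorm_pos_le[OF bounded_linear_diff] onorm_diff_less_1 by blast
qed

text \<open>
  The legs of the right triangle are \<open>q x\<close> and \<open>P x - q x\<close>, with hypotenuse \<open>P x\<close>. Both identities
  \<open>p (P x) = P x\<close> and \<open>q (P x) = q x\<close> are needed to see that \<open>P x - q x\<close> is the value of \<open>p - q\<close> at
  the hypotenuse.
\<close>

lemma norm_diff_onto_complement_le:
  "norm (P x - q x) \<le> tan (arcsin (onorm (\<lambda>x. p x - q x))) * norm x"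
proof -
  let ?s = "onorm (\<lambda>x. p x - q x)"
  have "norm (P x - q x) \<le> ?s * norm (P x)"
    using onorm[OF bounded_linear_diff, of "P x"] by (simp add: q_P p.fixes_mem range)
  then have "(norm (P x - q x))\<^sup>2 \<le> ?s\<^sup>2 * (norm (P x))\<^sup>2"
    by (metis norm_ge_zero power_mono power_mult_distrib)
  then have "norm (P x - q x) \<le> tan (arcsin ?s) * norm (q x)"
    using q.pythagoras[of "P x"] onorm_pos_le[OF bounded_linear_diff] onorm_diff_less_1
    by (intro tan_arcsin_le) (simp_all add: q_P add.commute)
  also have "\<dots> \<le> tan (arcsin ?s) * norm x"
    by (rule mult_left_mono[OF q.contraction tan_arcsin_onorm_diff_nonneg])
  finally show ?thesis .
qed

text \<open>
  This time the hypotenuse is \<open>y = x - P x\<close>, which \<open>q\<close> annihilates, so that \<open>p y\<close> is the value of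
  \<open>p - q\<close> at \<open>y\<close>. The legs are \<open>p y = p x - P x\<close> and \<open>x - p x\<close>.
\<close>

lemma norm_diff_onto_range_le:
  "norm (P x - p x) \<le> tan (arcsin (onorm (\<lambda>x. p x - q x))) * norm x"
proof -
  let ?s = "onorm (\<lambda>x. p x - q x)"
  define y where "y = x - P x"
  have qy: "q y = 0"
    by (simp add: y_def q.diff q_P)
  have py: "p y = p x - P x"
    by (simp add: y_def p.diff p.fixes_mem range)
  have "norm (p y) \<le> ?s * norm y"
    using onorm[OF bounded_linear_diff, of y] by (simp add: qy)
  then have "(norm (p y))\<^sup>2 \<le> ?s\<^sup>2 * (norm y)\<^sup>2"
    by (metis norm_ge_zero power_mono power_mult_distrib)
  then have "norm (p y) \<le> tan (arcsin ?s) * norm (y - p y)"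
    using p.pythagoras[of y] onorm_pos_le[OF bounded_linear_diff] onorm_diff_less_1
    by (intro tan_arcsin_le) simp_all
  also have "y - p y = x - p x"
    unfolding py by (simp add: y_def)
  also have "tan (arcsin ?s) * norm (x - p x) \<le> tan (arcsin ?s) * norm x"
    by (rule mult_left_mono[OF p.residual_contraction tan_arcsin_onorm_diff_nonneg])
  finally show ?thesis
    by (simp add: py norm_minus_commute)
qed

end

section \<open>Automatic boundedness\<close>

text \<open>
  By Baire, one of the countably many sublevel sets that cover the space contains a ball; translating
  the ball to the origin at most doubles the bound on it.
\<close>

lemma bounded_linear_if_sublevel_closed:
  fixes f :: "'a::{real_normed_vector, complete_space} \<Rightarrow> 'b::real_normed_vector"
  assumes lin: "linear f" and cl: "\<And>c. closed {x. norm (f x) \<le> c}"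
  shows "bounded_linear f"
proof -
  define A where "A n = {x. norm (f x) \<le> real n}" for n
  have "\<exists>n. interior (A n) \<noteq> {}"
  proof (rule ccontr)
    assume "\<not> ?thesis"
    then have "euclidean interior_of \<Union>(range A) = {}"
    proof (intro Baire_category_alt disjI1 completely_metrizable_space_euclidean)
      show "closedin euclidean T \<and> euclidean interior_of T = {}" if "T \<in> range A" for T
        using that \<open>\<not> (\<exists>n. interior (A n) \<noteq> {})\<close> cl by (auto simp: A_def)
    qed simp
    moreover have "\<Union>(range A) = UNIV"
      by (auto simp: A_def real_arch_simple)
    ultimately show False
      by simp
  qed
  then obtain n a r where r: "r > 0" "cball a r \<subseteq> A n"
    by (meson ex_in_conv mem_interior_cball)
  have "norm (f x) \<le> norm x * (2 * real n / r)" for x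
  proof (cases "x = 0")
    case True
    then show ?thesis using linear_0[OF lin] by simp
  next
    case False
    let ?y = "(r / norm x) *\<^sub>R x"
    have "a + ?y \<in> A n" "a \<in> A n"
      using r False by (auto simp: dist_norm intro!: subsetD[OF r(2)])
    then have "norm (f (a + ?y)) \<le> real n" "norm (f a) \<le> real n"
      unfolding A_def by blast+
    moreover have "norm (f ?y) \<le> norm (f (a + ?y)) + norm (f a)"
      using norm_triangle_ineq4[of "f (a + ?y)" "f a"] by (simp add: linear_add[OF lin])
    ultimately have "norm (f ?y) \<le> 2 * real n"
      by linarith
    then show ?thesis
      using r(1) False by (simp add: linear_scale[OF lin] field_simps)
  qed
  then show ?thesis
    using lin by (intro bounded_linear_intro) (blast intro: linear_add linear_scale)+
qed

lemma norm_le_iff_inner_dense: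
  fixes x :: "'a::real_inner"
  assumes dense: "closure D = UNIV"
  shows "norm x \<le> c \<longleftrightarrow> 0 \<le> c \<and> (\<forall>y\<in>D. x \<bullet> y \<le> c * norm y)" (is "_ \<longleftrightarrow> ?R")
proof
  assume x: "norm x \<le> c"
  have "x \<bullet> y \<le> c * norm y" for y
    using norm_cauchy_schwarz[of x y] mult_right_mono[OF x, of "norm y"] by simp
  then show ?R
    using order_trans[OF norm_ge_zero x] by blast
next
  assume R: ?R
  have "x \<bullet> y - c * norm y \<le> 0" if "y \<in> D" for y
    using R that by simp
  moreover have "continuous_on (closure D) (\<lambda>y. x \<bullet> y - c * norm y)"
    by (intro continuous_intros)
  ultimately have "x \<bullet> x - c * norm x \<le> 0"
    using continuous_le_on_closure[of D "\<lambda>y. x \<bullet> y - c * norm y" x 0] dense by blast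
  then have "norm x * norm x \<le> c * norm x"
    using power2_norm_eq_inner[of x] unfolding power2_eq_square by linarith
  then show "norm x \<le> c"
    using R mult_right_le_imp_le[of "norm x" "norm x" c] by (cases "x = 0") simp_all
qed

text \<open>
  Testing against a dense set determines the norm, so each sublevel set of \<open>norm (f x)\<close> is an
  intersection of the closed sets given by single test vectors \<open>y\<close>.
\<close>

lemma bounded_linear_if_weakly_continuous:
  fixes f :: "'a::{real_normed_vector, complete_space} \<Rightarrow> 'b::real_inner"
  assumes lin: "linear f" and dense: "closure D = UNIV"
    and cont: "\<And>y. y \<in> D \<Longrightarrow> continuous_on UNIV (\<lambda>x. f x \<bullet> y)"
  shows "bounded_linear f"
proof (rule bounded_linear_if_sublevel_closed[OF lin])
  fix c
  have "{x. norm (f x) \<le> c} = {x. 0 \<le> c} \<inter> (\<Inter>y\<in>D. {x. f x \<bullet> y \<le> c * norm y})"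
    by (auto simp: norm_le_iff_inner_dense[OF dense])
  also have "closed \<dots>"
    by (intro closed_Int closed_Collect_const closed_INT ballI closed_Collect_le cont continuous_on_const)
  finally show "closed {x. norm (f x) \<le> c}" .
qed

section \<open>Complex subspaces\<close>

lemma complex_subspace_imp_subspace:
  fixes M :: "'a::complex_hilbert set"
  assumes "complex_vector.subspace M"
  shows "subspace M"
  using assms unfolding subspace_def complex_vector.subspace_def scaleR_scaleC by blast

text \<open>
  The imaginary part of \<open>cinner x y\<close> is the real part of \<open>cinner (\<i> *\<^sub>C x) y\<close>.
\<close>

lemma cinner_0_iff_inner_scaleC:
  fixes x y :: "'a::complex_hilbert"
  shows "cinner x y = 0 \<longleftrightarrow> inner x y = 0 \<and> inner (\<i> *\<^sub>C x) y = 0"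
  unfolding inner_eq_Re_cinner cinner_scaleC_left complex_eq_iff by simp

lemma cinner_orthogonal_iff:
  fixes M :: "'a::complex_hilbert set"
  assumes "complex_vector.subspace M"
  shows "(\<forall>z\<in>M. cinner z x = 0) \<longleftrightarrow> (\<forall>z\<in>M. inner z x = 0)"
  unfolding cinner_0_iff_inner_scaleC using complex_vector.subspace_scale[OF assms] by blast

lemma orthogonal_projection_orth_proj:
  fixes M :: "'a::complex_hilbert set"
  assumes M: "complex_vector.subspace M" and cl: "closed M"
  shows "orthogonal_projection M (orth_proj M)"
proof -
  have sub: "subspace M"
    using M by (rule complex_subspace_imp_subspace)
  obtain p where p: "orthogonal_projection M p"
    using exists_orthogonal_projection[OF sub cl] sub
    unfolding orthogonal_projection_def by metis
  have "orth_proj M = p"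
  proof (rule ext)
    show "orth_proj M x = p x" for x
      unfolding orth_proj_def cinner_orthogonal_iff[OF M]
      using orthogonal_projection.unique[OF p] orthogonal_projection.mem[OF p]
        orthogonal_projection.residual[OF p]
      by (intro the_equality) blast+
  qed
  with p show ?thesis
    by simp
qed

lemma norm_scaleC:
  fixes x :: "'a::complex_hilbert"
  shows "norm (a *\<^sub>C x) = cmod a * norm x"
proof (rule power2_eq_imp_eq)
  have *: "cinner y (b *\<^sub>C z) = b * cinner y z" for y z :: 'a and b
    by (metis cinner_commute cinner_scaleC_left complex_cnj_cnj complex_cnj_mult)
  have "cinner (a *\<^sub>C x) (a *\<^sub>C x) = (a * cnj a) * cinner x x"
    unfolding cinner_scaleC_left * by simp
  then have "(norm (a *\<^sub>C x))\<^sup>2 = Re ((a * cnj a) * cinner x x)"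
    unfolding power2_norm_eq_inner inner_eq_Re_cinner by (rule arg_cong)
  also have "\<dots> = (cmod a)\<^sup>2 * Re (cinner x x)"
    unfolding complex_norm_square[symmetric] by simp
  finally show "(norm (a *\<^sub>C x))\<^sup>2 = (cmod a * norm x)\<^sup>2"
    by (simp only: power_mult_distrib power2_norm_eq_inner[of x] inner_eq_Re_cinner)
qed simp_all

lemma bounded_linear_scaleC: "bounded_linear ((*\<^sub>C) a :: 'a::complex_hilbert \<Rightarrow> 'a)"
  by (rule bounded_linear_intro[where K = "cmod a"])
    (simp_all add: scaleC_add_right scaleR_scaleC scaleC_scaleC norm_scaleC mult.commute)

lemma complex_subspace_closure:
  fixes M :: "'a::complex_hilbert set"
  assumes M: "complex_vector.subspace M"
  shows "complex_vector.subspace (closure M)"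
proof (rule complex_vector.subspaceI)
  show "0 \<in> closure M"
    using complex_vector.subspace_0[OF M] closure_subset by blast
  show "x + y \<in> closure M" if "x \<in> closure M" "y \<in> closure M" for x y
    using that complex_vector.subspace_add[OF M] unfolding closure_sequential
    by (metis (no_types, lifting) tendsto_add)
  show "a *\<^sub>C x \<in> closure M" if "x \<in> closure M" for a x
    using that complex_vector.subspace_scale[OF M] unfolding closure_sequential
    by (metis (no_types, lifting) bounded_linear.tendsto[OF bounded_linear_scaleC])
qed

section \<open>Self-adjoint operators\<close>

text \<open>
  Since \<open>D\<close> is dense, at most one vector can serve as the value of the adjoint at \<open>y\<close>; this is what
  lets the description of \<open>adjoint_operator\<close> be evaluated.
\<close>

lemma self_adjoint_symmetric:
  fixes H :: "'a::complex_hilbert \<Rightarrow> 'a"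
  assumes sa: "self_adjoint D H" and "x \<in> D" "y \<in> D"
  shows "H x \<bullet> y = x \<bullet> H y"
proof -
  have "y \<in> adjoint_domain D H" and Hy: "adjoint_operator D H y = H y"
    using assms unfolding self_adjoint_def by blast+
  then obtain z where z: "\<forall>x\<in>D. cinner (H x) y = cinner x z"
    unfolding adjoint_domain_def by blast
  have "z' = z" if z': "\<forall>x\<in>D. cinner (H x) y = cinner x z'" for z'
  proof -
    have "x \<bullet> z' = x \<bullet> z" if "x \<in> D" for x
      using z z' that unfolding inner_eq_Re_cinner by metis
    then have "x \<bullet> (z' - z) = 0" if "x \<in> D" for x
      using that by (simp add: inner_diff_right)
    moreover have "z' - z \<in> closure D"
      using sa by (simp add: self_adjoint_def)
    moreover have "continuous_on (closure D) (\<lambda>x. x \<bullet> (z' - z))"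
      by (intro continuous_intros)
    ultimately have "(z' - z) \<bullet> (z' - z) = 0"
      using continuous_constant_on_closure[of D "\<lambda>x. x \<bullet> (z' - z)" 0 "z' - z"] by blast
    then show ?thesis by simp
  qed
  with z have "adjoint_operator D H y = z"
    unfolding adjoint_operator_def by (intro the_equality)
  then show ?thesis
    using z Hy \<open>x \<in> D\<close> unfolding inner_eq_Re_cinner by simp
qed

text \<open>
  Conjugation by \<open>H\<close> carries the range \<open>U\<close> of \<open>orth_proj U\<close> to \<open>V\<close>, and its kernel to the vectors
  \<open>x\<close> with \<open>inv_into D H x\<close> orthogonal to \<open>U\<close>; moving the symmetric inverse to the other side
  of the inner product turns the latter into orthogonality to \<open>W\<close>. Invariance of \<open>D\<close> is what
  makes \<open>P\<close> defined everywhere: without it \<open>H\<close> would be applied outside its domain.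
\<close>

lemma oblique_projection_conjugate:
  fixes D U V W :: "'a::complex_hilbert set" and H P :: "'a \<Rightarrow> 'a"
  assumes sa: "self_adjoint D H" and bi: "has_bounded_inverse D H"
    and U: "complex_vector.subspace U" "closed U"
    and inv: "orth_proj U ` D \<subseteq> D"
    and V: "V = H ` (D \<inter> U)"
    and W: "W = closure (inv_into D H ` U)"
    and P: "P = H \<circ> orth_proj U \<circ> inv_into D H"
  shows "oblique_projection V W (orth_proj V) (orth_proj W) P"
proof -
  define T where "T = inv_into D H"
  interpret u: orthogonal_projection U "orth_proj U"
    using U by (rule orthogonal_projection_orth_proj)
  have D: "complex_vector.subspace D" and dense: "closure D = UNIV"
    and Hadd: "\<And>x y. x \<in> D \<Longrightarrow> y \<in> D \<Longrightarrow> H (x + y) = H x + H y"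
    and Hscale: "\<And>a x. x \<in> D \<Longrightarrow> H (a *\<^sub>C x) = a *\<^sub>C H x"
    using sa by (auto simp: self_adjoint_def linear_operator_def)
  have Tlin: "bounded_linear T" and bij: "bij_betw H D UNIV"
    using bi by (auto simp: has_bounded_inverse_def T_def)
  have TD: "T x \<in> D" and HT: "H (T x) = x" for x
    using bij by (auto simp: T_def bij_betw_def inv_into_into f_inv_into_f)
  have TH: "T (H x) = x" if "x \<in> D" for x
    using bij that by (simp add: T_def bij_betw_def inv_into_f_f)
  have Tsym: "T x \<bullet> y = x \<bullet> T y" for x y
    using self_adjoint_symmetric[OF sa TD TD, of x y] by (simp add: HT)
  have Tscale: "T (a *\<^sub>C x) = a *\<^sub>C T x" for a x
    using TH[OF complex_vector.subspace_scale[OF D TD]] by (simp add: Hscale TD HT)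
  have uD: "orth_proj U (T x) \<in> D" for x
    using inv TD by blast
  have Px: "P x = H (orth_proj U (T x))" for x
    by (simp add: P T_def)
  have "linear P"
  proof (rule linearI)
    show "P (x + y) = P x + P y" for x y
      by (simp add: Px linear_add[OF bounded_linear.linear[OF Tlin]] u.add Hadd uD)
    show "P (r *\<^sub>R x) = r *\<^sub>R P x" for r x
      by (simp add: Px linear_scale[OF bounded_linear.linear[OF Tlin]] u.scale
          scaleR_scaleC[of r "orth_proj U (T x)"] Hscale uD)
        (simp add: scaleR_scaleC)
  qed
  then have Plin: "bounded_linear P"
  proof (rule bounded_linear_if_weakly_continuous[OF _ dense])
    fix y assume "y \<in> D"
    then have "P x \<bullet> y = orth_proj U (T x) \<bullet> H y" for x
      by (simp add: Px self_adjoint_symmetric[OF sa uD])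
    then show "continuous_on UNIV (\<lambda>x. P x \<bullet> y)"
      by (simp add: continuous_intros bounded_linear.continuous_on[OF u.bounded_linear]
          bounded_linear.continuous_on[OF Tlin])
  qed
  have range: "P x \<in> V" for x
    using uD u.mem by (auto simp: V Px)
  have PV: "P v = v" if "v \<in> V" for v
    using that by (auto simp: V Px TH u.fixes_mem)
  \<comment> \<open>The range of a bounded idempotent is the set of its fixed points, hence closed.\<close>
  have V_eq: "V = {x. P x = x}"
    using range PV by auto (metis range)
  have clV: "closed V"
    unfolding V_eq 
    by (intro closed_Collect_eq bounded_linear.continuous_on[OF Plin] continuous_on_id)
  have subV: "complex_vector.subspace V"
  proof (rule complex_vector.subspaceI)
    have DU: "complex_vector.subspace (D \<inter> U)"
      using D U(1) by (rule complex_vector.subspace_inter)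
    have "H 0 = 0"
      using Hscale[of 0 0] complex_vector.subspace_0[OF D] by simp
    then show "0 \<in> V"
      unfolding V using complex_vector.subspace_0[OF DU] by (metis imageI)
    show "x + y \<in> V" if xy: "x \<in> V" "y \<in> V" for x y
    proof -
      obtain v w where "v \<in> D \<inter> U" "w \<in> D \<inter> U" "x = H v" "y = H w"
        using xy unfolding V by blast
      then show ?thesis
        using complex_vector.subspace_add[OF DU, of v w] Hadd[of v w] by (metis V IntD1 imageI)
    qed
    show "a *\<^sub>C x \<in> V" if x: "x \<in> V" for a x
    proof -
      obtain v where "v \<in> D \<inter> U" "x = H v"
        using x unfolding V by blast
      then show ?thesis
        using complex_vector.subspace_scale[OF DU, of v a] Hscale[of v a] by (metis V IntD1 imageI)
    qed
  qed
  have subTU: "complex_vector.subspace (T ` U)"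
  proof (rule complex_vector.subspaceI)
    show "0 \<in> T ` U"
      using linear_0[OF bounded_linear.linear[OF Tlin]] complex_vector.subspace_0[OF U(1)]
      by (metis imageI)
    show "x + y \<in> T ` U" if "x \<in> T ` U" "y \<in> T ` U" for x y
      using that complex_vector.subspace_add[OF U(1)]
      by (auto simp flip: linear_add[OF bounded_linear.linear[OF Tlin]])
    show "a *\<^sub>C x \<in> T ` U" if "x \<in> T ` U" for a x
      using that complex_vector.subspace_scale[OF U(1)] by (auto simp flip: Tscale)
  qed
  have subW: "complex_vector.subspace W"
    unfolding W T_def[symmetric] using subTU by (rule complex_subspace_closure)
  have kernel: "P x = 0 \<longleftrightarrow> (\<forall>w\<in>W. w \<bullet> x = 0)" for x
  proof -
    have "P x = 0 \<longleftrightarrow> orth_proj U (T x) = 0"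
      using TH[OF uD, of x] HT[of 0] linear_0[OF bounded_linear.linear[OF Tlin]] by (metis Px)
    also have "\<dots> \<longleftrightarrow> (\<forall>z\<in>U. z \<bullet> T x = 0)"
      using u.vanishes[of "T x"] u.inner_right[of _ "T x"] by auto
    also have "\<dots> \<longleftrightarrow> (\<forall>w\<in>T ` U. w \<bullet> x = 0)"
      by (simp add: Tsym)
    also have "\<dots> \<longleftrightarrow> (\<forall>w\<in>W. w \<bullet> x = 0)"
    proof
      assume "\<forall>w\<in>T ` U. w \<bullet> x = 0"
      moreover have "continuous_on (closure (T ` U)) (\<lambda>w. w \<bullet> x)"
        by (intro continuous_intros)
      ultimately show "\<forall>w\<in>W. w \<bullet> x = 0"
        unfolding W T_def[symmetric]
        using continuous_constant_on_closure[of "T ` U" "\<lambda>w. w \<bullet> x" 0] by blast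
    next
      assume "\<forall>w\<in>W. w \<bullet> x = 0"
      then show "\<forall>w\<in>T ` U. w \<bullet> x = 0"
        unfolding W T_def[symmetric] using closure_subset by blast
    qed
    finally show ?thesis .
  qed
  interpret v: orthogonal_projection V "orth_proj V"
    using subV clV by (rule orthogonal_projection_orth_proj)
  interpret w: orthogonal_projection W "orth_proj W"
    using subW by (rule orthogonal_projection_orth_proj) (simp add: W)
  show "oblique_projection V W (orth_proj V) (orth_proj W) P"
    by (intro oblique_projection.intro v.orthogonal_projection_axioms
        w.orthogonal_projection_axioms oblique_projection_axioms.intro Plin range PV kernel)
qed

theorem theorem3p11:
  fixes D U V W :: "'a::complex_hilbert set" and H P :: "'a \<Rightarrow> 'a"
  assumes "self_adjoint D H"
    and "has_bounded_inverse D H"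
    and "complex_vector.subspace U" and "closed U"
    and "orth_proj U ` D \<subseteq> D"
    and "V = H ` (D \<inter> U)"
    and "W = closure (inv_into D H ` U)"
    and "P = H \<circ> orth_proj U \<circ> inv_into D H"
  shows "onorm (\<lambda>x. orth_proj U x - P x)
    \<le> min (sin (max_angle U V)) (sin (max_angle U W)) + tan (max_angle V W)"
proof -
  interpret oblique_projection V W "orth_proj V" "orth_proj W" P
    using assms by (rule oblique_projection_conjugate)
  have U: "orthogonal_projection U (orth_proj U)"
    using assms(3,4) by (rule orthogonal_projection_orth_proj)
  let ?t = "tan (max_angle V W)"
  have onorm_le: "onorm (\<lambda>x. orth_proj U x - P x) \<le> sin (max_angle U M) + ?t"
    if M: "orthogonal_projection M (orth_proj M)"
      and close: "\<And>x. norm (P x - orth_proj M x) \<le> ?t * norm x" for M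
  proof -
    let ?d = "\<lambda>x. orth_proj U x - orth_proj M x"
    have d: "bounded_linear ?d"
      using U M by (intro bounded_linear_sub orthogonal_projection.bounded_linear)
    have sin: "sin (max_angle U M) = onorm ?d"
      unfolding max_angle_def
      using onorm_pos_le[OF d] onorm_diff_orthogonal_projection_le_1[OF U M] by simp
    have "norm (orth_proj U x - P x) \<le> (onorm ?d + ?t) * norm x" for x
      using onorm[OF d, of x] close[of x]
        norm_triangle_ineq4[of "?d x" "P x - orth_proj M x"] by (simp add: algebra_simps)
    moreover have "0 \<le> ?t"
      unfolding max_angle_def by (rule tan_arcsin_onorm_diff_nonneg)
    ultimately show ?thesis
      unfolding sin using onorm_pos_le[OF d] by (intro onorm_bound) simp_all
  qed
  have "onorm (\<lambda>x. orth_proj U x - P x) \<le> sin (max_angle U V) + ?t"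
    using p.orthogonal_projection_axioms norm_diff_onto_range_le
    by (intro onorm_le) (simp_all add: max_angle_def)
  moreover have "onorm (\<lambda>x. orth_proj U x - P x) \<le> sin (max_angle U W) + ?t"
    using q.orthogonal_projection_axioms norm_diff_onto_complement_le
    by (intro onorm_le) (simp_all add: max_angle_def)
  ultimately show ?thesis
    by linarith
qed

end
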